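(* Let $n\ge1$ be an integer, $\lambda_1,\dots,\lambda_n>0$, $T>0$, $m,c,\sigma,\beta>0$, $\mu>r>0$, and let $Y$ be a positive random variable such that $z(t):=\mathbb{E}(e^{mYe^{r(T-t)}})<+\infty$ for all $t\in[0,T]$. Then the system $$\begin{cases} \varphi_i'(t)-\lambda_i\varphi_i(t)+\lambda_i\varphi_{i+1}(t)=0, & i=1,\dots,n-1,\\ \varphi_n'(t)-\lambda_n\varphi_n(t)+\lambda_n z(t)\varphi_1(t)=0, \end{cases}\qquad t\in[0,T],$$ with terminal condition $\varphi_i(T)=e^{-F(T)}$ for $i=1,\dots,n$, where $$F(t)=\frac{c m}{r} e^{r T}\left(1-e^{-r t}\right)+\frac{(2 \beta+1)(\mu-r)^{2}}{4 r} t+\frac{(2 \beta+1)(\mu-r)^{2}}{8 \beta r^{2}} e^{-2 \beta r T}\left(1-e^{2 \beta r t}\right),$$ admits a unique solution $(\varphi_1,\dots,\varphi_n)$ such that $\varphi_i\in C^1([0,T];\mathbb{R}_+)$ for all $i=1,2,\dots,n$.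
   Context: $\mathbb R_+=[0,\infty)$. For $n=1$ the system consists of the last equation only. *)

theory Defs
  imports "HOL-Probability.Probability"
begin

text \<open>
  \<open>C1_fun a b B\<close> is \<open>C\<^sup>1([a,b]; B)\<close>. Derivatives are taken within \<open>[a,b]\<close>, hence one-sided at the
  endpoints. Elements are extensional (\<open>undefined\<close> outside \<open>[a,b]\<close>), so that equality of elements
  is equality of functions on \<open>[a,b]\<close>; the library's \<open>C1_differentiable_on\<close> uses
  unrestricted derivatives and is not suitable here.
\<close>

definition C1_fun :: "real \<Rightarrow> real \<Rightarrow> real set \<Rightarrow> (real \<Rightarrow> real) set" where
  "C1_fun a b B = {f \<in> {a..b} \<rightarrow>\<^sub>E B.
     (\<forall>t\<in>{a..b}. f differentiable (at t within {a..b})) \<and>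
     continuous_on {a..b} (\<lambda>t. vector_derivative f (at t within {a..b}))}"

definition F_term :: "real \<Rightarrow> real \<Rightarrow> real \<Rightarrow> real \<Rightarrow> real \<Rightarrow> real \<Rightarrow> real \<Rightarrow> real" where
  "F_term c m r \<mu> \<beta> T t =
     c * m / r * exp (r * T) * (1 - exp (- r * t))
     + (2 * \<beta> + 1) * (\<mu> - r)\<^sup>2 / (4 * r) * t
     + (2 * \<beta> + 1) * (\<mu> - r)\<^sup>2 / (8 * \<beta> * r\<^sup>2) * exp (- 2 * \<beta> * r * T)
         * (1 - exp (2 * \<beta> * r * t))"

definition z_fun :: "'a measure \<Rightarrow> ('a \<Rightarrow> real) \<Rightarrow> real \<Rightarrow> real \<Rightarrow> real \<Rightarrow> real \<Rightarrow> real" where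
  "z_fun M Y m r T t = prob_space.expectation M (\<lambda>\<omega>. exp (m * Y \<omega> * exp (r * (T - t))))"

end

theory Submission
  imports Defs
begin

text \<open>
  Multiplying \<open>\<phi>\<^sub>i\<close> by \<open>exp (- \<lambda>\<^sub>i t)\<close> removes the diagonal terms and leaves
  \<open>\<psi>\<^sub>i' = - a\<^sub>i \<psi>\<^sub>j\<close>, where \<open>j\<close> is the cyclic successor of \<open>i\<close> and the coefficients \<open>a\<^sub>i\<close> are continuous
  and nonnegative. The Picard series of this backward system has nonnegative terms,
  dominated by an exponential series; hence it converges to a nonnegative solution, and the same
  factorial bound, applied to the difference of two solutions, gives uniqueness. Continuity of \<open>z\<close>
  follows by dominated convergence from its finiteness at \<open>t = 0\<close>.
\<close>

section \<open>Factorial estimates and uniform bounds\<close>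

text \<open>The induction step of every factorial estimate below: integrating a bound of order
  \<open>j\<close> back from the terminal time \<open>b\<close>, where \<open>f\<close> vanishes,
  gains a factor \<open>A * (b - t)\<close> and raises the factorial by one.\<close>

lemma abs_le_power_fact_Suc:
  fixes f f' :: "real \<Rightarrow> real"
  assumes der: "\<And>t. t \<in> {a..b} \<Longrightarrow> (f has_real_derivative f' t) (at t within {a..b})"
    and bound: "\<And>t. t \<in> {a..b} \<Longrightarrow> \<bar>f' t\<bar> \<le> A * (B * (A * (b - t)) ^ j / fact j)"
    and "f b = 0" and t: "t \<in> {a..b}"
  shows "\<bar>f t\<bar> \<le> B * (A * (b - t)) ^ Suc j / fact (Suc j)"
proof -
  define g where "g s = B * (A * (b - s)) ^ Suc j / fact (Suc j)" for s
  have g: "(g has_real_derivative - (A * (B * (A * (b - s)) ^ j / fact j))) (at s within {t..b})" for s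
  proof -
    have "((\<lambda>s. A * (b - s)) has_real_derivative - A) (at s within {t..b})"
      by (auto intro!: derivative_eq_intros)
    from DERIV_cdivide[OF DERIV_cmult[OF DERIV_power_Suc[OF this, of j], of B], of "fact (Suc j)"]
    show ?thesis
      unfolding g_def by (rule DERIV_cong) (simp add: divide_simps add.commute[of 1])
  qed
  have f: "(f has_real_derivative f' s) (at s within {t..b})" if "s \<in> {t..b}" for s
    using der[of s] t that by (auto intro: DERIV_subset)
  have gb: "g b = 0" by (simp add: g_def)
  \<comment> \<open>The signs 1 and -1 give the two halves of the absolute value. The derivative of
    \<open>g\<close> is minus the assumed bound on the absolute value of \<open>f'\<close>, so
    \<open>g - \<epsilon> * f\<close> has nonpositive derivative; it vanishes at \<open>b\<close>,
    hence is nonnegative at \<open>t\<close>.\<close>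
  have "g t \<ge> \<epsilon> * f t" if e: "\<bar>\<epsilon>\<bar> = 1" for \<epsilon> :: real
  proof -
    have d: "((\<lambda>s. g s - \<epsilon> * f s) has_derivative
        (*) (- (A * (B * (A * (b - s)) ^ j / fact j)) - \<epsilon> * f' s)) (at s within {t..b})"
      if "s \<in> {t..b}" for s
      unfolding has_field_derivative_def[symmetric]
      by (intro DERIV_diff g DERIV_cmult f that)
    have tb: "t \<le> b" using t by simp
    from mvt_very_simple[OF tb d] obtain s where s: "s \<in> {t..b}"
      and eq: "(g b - \<epsilon> * f b) - (g t - \<epsilon> * f t)
        = (- (A * (B * (A * (b - s)) ^ j / fact j)) - \<epsilon> * f' s) * (b - t)"
      by auto
    have "\<bar>\<epsilon> * f' s\<bar> \<le> A * (B * (A * (b - s)) ^ j / fact j)"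
      using bound[of s] s t e by (simp add: abs_mult)
    then have "- (A * (B * (A * (b - s)) ^ j / fact j)) - \<epsilon> * f' s \<le> 0" by linarith
    then have "(g b - \<epsilon> * f b) - (g t - \<epsilon> * f t) \<le> 0"
      unfolding eq using tb by (intro mult_nonpos_nonneg) auto
    then show ?thesis using gb \<open>f b = 0\<close> by simp
  qed
  from this[of 1] this[of "-1"] show ?thesis unfolding g_def by simp
qed

lemma power_over_fact_tendsto_0:
  fixes x :: real
  shows "(\<lambda>j. B * x ^ j / fact j) \<longlonglongrightarrow> 0"
proof -
  have "(\<lambda>j. B * (inverse (fact j) * x ^ j)) \<longlonglongrightarrow> 0"
    by (intro tendsto_mult_right_zero summable_LIMSEQ_zero summable_exp)
  then show ?thesis by (simp add: field_simps)
qed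

text \<open>A finite union of compact images is bounded. A constant common to all components is
  wanted because iterating the equation passes from component \<open>i\<close> to
  \<open>s i\<close>.\<close>

lemma continuous_family_bounded:
  fixes f :: "'i \<Rightarrow> real \<Rightarrow> real"
  assumes "finite I" and "\<And>i. i \<in> I \<Longrightarrow> continuous_on {a..b} (f i)"
  obtains B where "B \<ge> 0" "\<And>i t. i \<in> I \<Longrightarrow> t \<in> {a..b} \<Longrightarrow> \<bar>f i t\<bar> \<le> B"
proof -
  have "bounded (\<Union>i\<in>I. f i ` {a..b})"
    using assms by (intro bounded_UN) (auto intro!: compact_imp_bounded compact_continuous_image)
  then obtain B where "B > 0" "\<forall>x\<in>(\<Union>i\<in>I. f i ` {a..b}). norm x \<le> B"
    unfolding bounded_pos by blast
  then show ?thesis by (intro that[of B]) auto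
qed

subsection \<open>Backward systems without diagonal terms\<close>

text \<open>The single terms of the Picard series, not its partial sums: term 0 is the terminal
  vector, and each later term is driven by the one before it and has terminal value 0.\<close>

primrec picard :: "('i \<Rightarrow> real \<Rightarrow> real) \<Rightarrow> ('i \<Rightarrow> 'i) \<Rightarrow> ('i \<Rightarrow> real) \<Rightarrow> real \<Rightarrow> nat \<Rightarrow> 'i \<Rightarrow> real \<Rightarrow> real" where
  "picard q s k b 0 = (\<lambda>i t. k i)"
| "picard q s k b (Suc j) = (\<lambda>i t. integral {t..b} (\<lambda>u. q i u * picard q s k b j (s i) u))"

text \<open>Feeding the equation into itself \<open>j\<close> times sharpens a crude bound
  \<open>B\<close> to \<open>B * (A * (b - t)) ^ j / fact j\<close>, which tends to 0. By linearity
  this yields uniqueness.\<close>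

lemma backward_system_zero:
  fixes d q :: "'i \<Rightarrow> real \<Rightarrow> real"
  assumes fin: "finite I" and s: "s \<in> I \<rightarrow> I"
    and q: "\<And>i. i \<in> I \<Longrightarrow> continuous_on {a..b} (q i)"
    and der: "\<And>i t. i \<in> I \<Longrightarrow> t \<in> {a..b} \<Longrightarrow>
      (d i has_real_derivative - (q i t * d (s i) t)) (at t within {a..b})"
    and term0: "\<And>i. i \<in> I \<Longrightarrow> d i b = 0"
    and i: "i \<in> I" and t: "t \<in> {a..b}"
  shows "d i t = 0"
proof -
  obtain A where A: "A \<ge> 0" "\<And>i t. i \<in> I \<Longrightarrow> t \<in> {a..b} \<Longrightarrow> \<bar>q i t\<bar> \<le> A"
    using continuous_family_bounded[OF fin, of a b q] q by blast
  have "continuous_on {a..b} (d i)" if "i \<in> I" for i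
    using der[OF that] by (rule DERIV_continuous_on)
  then obtain B where B: "B \<ge> 0" "\<And>i t. i \<in> I \<Longrightarrow> t \<in> {a..b} \<Longrightarrow> \<bar>d i t\<bar> \<le> B"
    using continuous_family_bounded[OF fin, of a b d] by blast
  have bound: "\<bar>d i t\<bar> \<le> B * (A * (b - t)) ^ j / fact j" if "i \<in> I" "t \<in> {a..b}" for i t j
    using that
  proof (induction j arbitrary: i t)
    case 0
    then show ?case using B(2) by simp
  next
    case (Suc j)
    show ?case
    proof (rule abs_le_power_fact_Suc[OF der])
      show "\<bar>- (q i u * d (s i) u)\<bar> \<le> A * (B * (A * (b - u)) ^ j / fact j)"
        if "u \<in> {a..b}" for u
        unfolding abs_minus_cancel abs_mult
        using A Suc.IH[OF _ that] Suc.prems s that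
        by (intro mult_mono) auto
    qed (use Suc.prems term0 in auto)
  qed
  have "\<bar>d i t\<bar> \<le> 0"
    by (rule LIMSEQ_le_const[OF power_over_fact_tendsto_0]) (use bound[OF i t] in blast)
  then show ?thesis by simp
qed

text \<open>The solution is the sum of the Picard terms. These are nonnegative because
  \<open>q\<close> and \<open>k\<close> are, and the factorial bound permits summation and termwise
  differentiation.\<close>

lemma backward_system_exists:
  fixes q :: "'i \<Rightarrow> real \<Rightarrow> real"
  assumes fin: "finite I" and s: "s \<in> I \<rightarrow> I" and ab: "a \<le> b"
    and q: "\<And>i. i \<in> I \<Longrightarrow> continuous_on {a..b} (q i)"
    and q0: "\<And>i t. i \<in> I \<Longrightarrow> t \<in> {a..b} \<Longrightarrow> q i t \<ge> 0"
    and k0: "\<And>i. i \<in> I \<Longrightarrow> k i \<ge> 0"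
  shows "\<exists>\<psi>. \<forall>i\<in>I. \<psi> i b = k i \<and> (\<forall>t\<in>{a..b}. \<psi> i t \<ge> 0 \<and>
    (\<psi> i has_real_derivative - (q i t * \<psi> (s i) t)) (at t within {a..b}))"
proof -
  define p where "p = picard q s k b"
  have p_Suc: "p (Suc j) i = (\<lambda>t. integral {t..b} (\<lambda>u. q i u * p j (s i) u))" for i j
    by (simp add: p_def)
  have p_0: "p 0 i t = k i" for i t by (simp add: p_def)
  have cont: "continuous_on {a..b} (p j i)" if "i \<in> I" for i j
    using that
  proof (induction j arbitrary: i)
    case (Suc j)
    have "continuous_on {a..b} (\<lambda>u. q i u * p j (s i) u)"
      using Suc s by (intro continuous_intros q) auto
    then show ?case
      unfolding p_Suc using integral_has_real_derivative' by (intro DERIV_continuous_on) blast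
  qed (simp add: p_def)
  \<comment> \<open>The variable is the lower limit of integration, hence the minus sign.\<close>
  have der: "(p (Suc j) i has_real_derivative - (q i t * p j (s i) t)) (at t within {a..b})"
    if "i \<in> I" "t \<in> {a..b}" for i j t
    unfolding p_Suc using that s
    by (intro integral_has_real_derivative' continuous_intros q cont) auto
  have nonneg: "p j i t \<ge> 0" if "i \<in> I" "t \<in> {a..b}" for i j t
    using that
  proof (induction j arbitrary: i t)
    case (Suc j)
    have "{t..b} \<subseteq> {a..b}" using Suc.prems by auto
    moreover have "continuous_on {a..b} (\<lambda>u. q i u * p j (s i) u)"
      using Suc s by (intro continuous_intros q cont) auto
    ultimately have "(\<lambda>u. q i u * p j (s i) u) integrable_on {t..b}"
      using continuous_on_subset integrable_continuous_real by blast
    then show ?case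
      unfolding p_Suc using Suc funcset_mem[OF s] by (intro integral_nonneg mult_nonneg_nonneg q0) auto
  qed (simp add: p_0 k0)
  obtain A where A: "A \<ge> 0" "\<And>i t. i \<in> I \<Longrightarrow> t \<in> {a..b} \<Longrightarrow> \<bar>q i t\<bar> \<le> A"
    using continuous_family_bounded[OF fin, of a b q] q by blast
  \<comment> \<open>The terminal values are viewed as constant functions to obtain one bound for all
    of them.\<close>
  obtain B where B: "B \<ge> 0" "\<And>i t. i \<in> I \<Longrightarrow> t \<in> {a..b} \<Longrightarrow> \<bar>k i\<bar> \<le> B"
    using continuous_family_bounded[OF fin, of a b "\<lambda>i _. k i"] by auto
  have bound: "\<bar>p j i t\<bar> \<le> B * (A * (b - t)) ^ j / fact j" if "i \<in> I" "t \<in> {a..b}" for i t j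
    using that
  proof (induction j arbitrary: i t)
    case 0
    then show ?case using B(2) by (simp add: p_0)
  next
    case (Suc j)
    show ?case
    proof (rule abs_le_power_fact_Suc[OF der])
      show "\<bar>- (q i u * p j (s i) u)\<bar> \<le> A * (B * (A * (b - u)) ^ j / fact j)"
        if "u \<in> {a..b}" for u
        unfolding abs_minus_cancel abs_mult
        using A Suc.IH[OF _ that] Suc.prems s that
        by (intro mult_mono) auto
    qed (use Suc.prems in \<open>auto simp: p_Suc\<close>)
  qed
  \<comment> \<open>The factorial bound is largest at \<open>t = a\<close>; its value there is a
    majorant independent of \<open>i\<close> and \<open>t\<close>.\<close>
  define C where "C j = B * (A * (b - a)) ^ j / fact j" for j
  have C: "\<bar>p j i t\<bar> \<le> C j" if "i \<in> I" "t \<in> {a..b}" for i t j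
  proof -
    have "B * (A * (b - t)) ^ j / fact j \<le> C j"
      unfolding C_def using A(1) B(1) that
      by (intro divide_right_mono mult_left_mono power_mono) auto
    with bound[OF that, of j] show ?thesis by linarith
  qed
  have sumC: "summable C"
  proof -
    have "summable (\<lambda>j. B * (inverse (fact j) * (A * (b - a)) ^ j))"
      by (intro summable_mult summable_exp)
    then show ?thesis unfolding C_def by (simp add: field_simps)
  qed
  have sump: "summable (\<lambda>j. p j i t)" if "i \<in> I" "t \<in> {a..b}" for i t
    by (rule summable_comparison_test'[OF sumC]) (use C[OF that] in auto)
  define \<psi> where "\<psi> i t = (\<Sum>j. p j i t)" for i t
  show ?thesis
  proof (intro exI[of _ \<psi>] ballI conjI)
    fix i t assume i: "i \<in> I" and t: "t \<in> {a..b}"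
    have si: "s i \<in> I" using s i by auto
    \<comment> \<open>The series of derivatives: term \<open>Suc j\<close> has derivative
      \<open>- (q i t * p j (s i) t)\<close>, which \<open>A * C j\<close> majorizes.\<close>
    have "uniform_limit {a..b} (\<lambda>n t. \<Sum>j<n. - (q i t * p j (s i) t))
        (\<lambda>t. \<Sum>j. - (q i t * p j (s i) t)) sequentially"
    proof (rule Weierstrass_m_test)
      show "norm (- (q i u * p j (s i) u)) \<le> A * C j" if "u \<in> {a..b}" for u j
        using A C[OF si that] i that by (auto simp: abs_mult intro!: mult_mono)
      show "summable (\<lambda>j. A * C j)" by (intro summable_mult sumC)
    qed
    \<comment> \<open>The constant head term is split off, since \<open>der\<close> describes the
      terms from index 1 on; \<open>k i\<close> is added back in \<open>eq\<close>.\<close>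
    moreover have "summable (\<lambda>j. p (Suc j) i t)"
      using sump[OF i t] summable_Suc_iff[of "\<lambda>j. p j i t"] by simp
    ultimately have "\<exists>g. \<forall>u\<in>{a..b}. (\<lambda>j. p (Suc j) i u) sums g u \<and>
        (g has_real_derivative (\<Sum>j. - (q i u * p j (s i) u))) (at u within {a..b})"
      by (intro has_field_derivative_series[OF convex_real_interval(5) der[OF i] _ t])
    then obtain g where g: "\<And>u. u \<in> {a..b} \<Longrightarrow> (\<lambda>j. p (Suc j) i u) sums g u"
      "\<And>u. u \<in> {a..b} \<Longrightarrow>
        (g has_real_derivative (\<Sum>j. - (q i u * p j (s i) u))) (at u within {a..b})"
      by blast
    have eq: "\<psi> i u = k i + g u" if "u \<in> {a..b}" for u
      unfolding \<psi>_def
      using suminf_split_head[OF sump[OF i that]] g(1)[OF that] by (simp add: p_0 sums_iff)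
    have "(\<Sum>j. - (q i t * p j (s i) t)) = - (q i t * \<psi> (s i) t)"
      unfolding \<psi>_def using sump[OF si t]
      by (simp add: suminf_minus suminf_mult summable_mult)
    then have "((\<lambda>u. k i + g u) has_real_derivative - (q i t * \<psi> (s i) t)) (at t within {a..b})"
      using g(2)[OF t] by (auto intro!: derivative_eq_intros)
    with t eq show "(\<psi> i has_real_derivative - (q i t * \<psi> (s i) t)) (at t within {a..b})"
      unfolding has_real_derivative_iff_has_vector_derivative by (rule has_vector_derivative_transform)
    show "\<psi> i t \<ge> 0"
      unfolding \<psi>_def by (intro suminf_nonneg sump nonneg i t)
  next
    fix i assume i: "i \<in> I"
    \<comment> \<open>Each later term is an integral over the single point \<open>b\<close>, so only
      the head survives.\<close>
    have "p (Suc j) i b = 0" for j by (simp add: p_Suc)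
    then show "\<psi> i b = k i"
      unfolding \<psi>_def using suminf_split_head[OF sump[OF i, of b]] ab by (simp add: p_0)
  qed
qed

subsection \<open>Backward systems with diagonal terms\<close>

text \<open>\<open>exp (- l * u)\<close> is the integrating factor that cancels the diagonal term.
  Inserting \<open>exp (l' * t) * exp (- l' * t) = 1\<close> expresses the coupling through the
  neighbour \<open>g\<close> weighted with its own rate \<open>l'\<close>.\<close>

lemma exp_weighted_derivative:
  fixes f g :: "real \<Rightarrow> real"
  assumes "(f has_real_derivative l * f t - q * g t) (at t within S)"
  shows "((\<lambda>u. exp (- l * u) * f u) has_real_derivative
    - ((exp (- l * t) * q * exp (l' * t)) * (exp (- l' * t) * g t))) (at t within S)"
proof -
  have "exp (l' * t) * exp (- l' * t) = 1" by (simp flip: exp_add)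
  then have *: "(exp (- l * t) * q * exp (l' * t)) * (exp (- l' * t) * g t) = exp (- l * t) * (q * g t)"
    by (simp only: mult.assoc mult.left_commute[of "exp (l' * t)"]) (simp add: mult.left_commute)
  have "((\<lambda>u. exp (- l * u)) has_real_derivative exp (- l * t) * - l) (at t within S)"
    by (auto intro!: derivative_eq_intros)
  from DERIV_mult[OF this assms] show ?thesis
    unfolding * by (rule DERIV_cong) (simp add: algebra_simps)
qed

text \<open>The difference of two solutions, times the integrating factor, solves a system without
  diagonal terms and vanishes at \<open>b\<close>.\<close>

lemma backward_diagonal_system_unique:
  fixes \<phi> \<phi>' q :: "'i \<Rightarrow> real \<Rightarrow> real"
  assumes fin: "finite I" and s: "s \<in> I \<rightarrow> I"
    and q: "\<And>i. i \<in> I \<Longrightarrow> continuous_on {a..b} (q i)"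
    and der: "\<And>i t. i \<in> I \<Longrightarrow> t \<in> {a..b} \<Longrightarrow>
      (\<phi> i has_real_derivative l i * \<phi> i t - q i t * \<phi> (s i) t) (at t within {a..b})"
    and der': "\<And>i t. i \<in> I \<Longrightarrow> t \<in> {a..b} \<Longrightarrow>
      (\<phi>' i has_real_derivative l i * \<phi>' i t - q i t * \<phi>' (s i) t) (at t within {a..b})"
    and terminal: "\<And>i. i \<in> I \<Longrightarrow> \<phi> i b = \<phi>' i b"
    and i: "i \<in> I" and t: "t \<in> {a..b}"
  shows "\<phi> i t = \<phi>' i t"
proof -
  define d where "d i t = exp (- l i * t) * (\<phi> i t - \<phi>' i t)" for i t
  define w where "w i t = exp (- l i * t) * q i t * exp (l (s i) * t)" for i t
  have "d i t = 0"
  proof (rule backward_system_zero[OF fin s _ _ _ i t])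
    show "continuous_on {a..b} (w i)" if "i \<in> I" for i
      unfolding w_def by (intro continuous_intros q that)
    show "(d i has_real_derivative - (w i t * d (s i) t)) (at t within {a..b})"
      if "i \<in> I" "t \<in> {a..b}" for i t
      unfolding d_def w_def
      by (rule exp_weighted_derivative, rule DERIV_cong[OF DERIV_diff[OF der der']])
        (use that in \<open>auto simp: algebra_simps\<close>)
  qed (simp add: d_def terminal)
  then show ?thesis by (simp add: d_def)
qed

text \<open>The weighted system is solved with terminal values \<open>exp (- l i * b) * k i\<close>,
  and the weight is then removed. Since the weights are positive, nonnegativity survives both
  passages.\<close>

lemma backward_diagonal_system_exists:
  fixes q :: "'i \<Rightarrow> real \<Rightarrow> real"
  assumes fin: "finite I" and s: "s \<in> I \<rightarrow> I" and ab: "a \<le> b"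
    and q: "\<And>i. i \<in> I \<Longrightarrow> continuous_on {a..b} (q i)"
    and q0: "\<And>i t. i \<in> I \<Longrightarrow> t \<in> {a..b} \<Longrightarrow> q i t \<ge> 0"
    and k0: "\<And>i. i \<in> I \<Longrightarrow> k i \<ge> 0"
  shows "\<exists>\<phi>. \<forall>i\<in>I. \<phi> i b = k i \<and> (\<forall>t\<in>{a..b}. \<phi> i t \<ge> 0 \<and>
    (\<phi> i has_real_derivative l i * \<phi> i t - q i t * \<phi> (s i) t) (at t within {a..b}))"
proof -
  define w where "w i t = exp (- l i * t) * q i t * exp (l (s i) * t)" for i t
  have w: "continuous_on {a..b} (w i)" if "i \<in> I" for i
    unfolding w_def by (intro continuous_intros q that)
  have w0: "w i t \<ge> 0" if "i \<in> I" "t \<in> {a..b}" for i t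
    unfolding w_def using q0[OF that] by simp
  have "exp (- l i * b) * k i \<ge> 0" if "i \<in> I" for i using k0[OF that] by simp
  from backward_system_exists[OF fin s ab w w0 this]
  obtain \<psi> where "\<forall>i\<in>I. \<psi> i b = exp (- l i * b) * k i \<and> (\<forall>t\<in>{a..b}. \<psi> i t \<ge> 0 \<and>
    (\<psi> i has_real_derivative - (w i t * \<psi> (s i) t)) (at t within {a..b}))" ..
  then have \<psi>:
    "\<And>i t. i \<in> I \<Longrightarrow> t \<in> {a..b} \<Longrightarrow>
      (\<psi> i has_real_derivative - (w i t * \<psi> (s i) t)) (at t within {a..b})"
    "\<And>i t. i \<in> I \<Longrightarrow> t \<in> {a..b} \<Longrightarrow> \<psi> i t \<ge> 0"
    "\<And>i. i \<in> I \<Longrightarrow> \<psi> i b = exp (- l i * b) * k i"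
    by auto
  show ?thesis
  proof (intro exI[of _ "\<lambda>i t. exp (l i * t) * \<psi> i t"] ballI conjI)
    fix i t assume i: "i \<in> I" and t: "t \<in> {a..b}"
    have "exp (l i * t) * exp (- l i * t) = 1" by (simp flip: exp_add)
    then have "exp (l i * t) * w i t = q i t * exp (l (s i) * t)"
      unfolding w_def by (simp flip: mult.assoc)
    then have "q i t * (exp (l (s i) * t) * \<psi> (s i) t) = (exp (l i * t) * w i t) * \<psi> (s i) t"
      by (simp only: mult.assoc)
    \<comment> \<open>The right-hand side is the form in which the product rule delivers the
      derivative.\<close>
    then have *: "l i * (exp (l i * t) * \<psi> i t) - q i t * (exp (l (s i) * t) * \<psi> (s i) t)
        = exp (l i * t) * l i * \<psi> i t + - (w i t * \<psi> (s i) t) * exp (l i * t)"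
      by (simp only: mult_ac add_ac diff_conv_add_uminus mult_minus_left mult_minus_right)
    have "((\<lambda>t. exp (l i * t)) has_real_derivative exp (l i * t) * l i) (at t within {a..b})"
      by (auto intro!: derivative_eq_intros)
    from DERIV_mult[OF this \<psi>(1)[OF i t]]
    show "((\<lambda>t. exp (l i * t) * \<psi> i t) has_real_derivative
        l i * (exp (l i * t) * \<psi> i t) - q i t * (exp (l (s i) * t) * \<psi> (s i) t)) (at t within {a..b})"
      unfolding * .
    show "exp (l i * t) * \<psi> i t \<ge> 0" using \<psi>(2)[OF i t] by simp
  next
    fix i assume "i \<in> I"
    moreover have "exp (l i * b) * exp (- l i * b) = 1" by (simp flip: exp_add)
    ultimately show "exp (l i * b) * \<psi> i b = k i" by (simp add: \<psi>(3) flip: mult.assoc)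
  qed
qed

subsection \<open>The exponential moment and the function space\<close>

text \<open>Dominated convergence: as \<open>Y\<close> is almost surely positive and
  \<open>m\<close>, \<open>r\<close> are nonnegative, the integrand is almost surely largest at time
  0, and its value there is the integrable majorant.\<close>

lemma z_fun_continuous:
  assumes [measurable]: "Y \<in> borel_measurable M"
    and pos: "AE \<omega> in M. Y \<omega> > 0" and "m \<ge> 0" "r \<ge> 0"
    and int: "integrable M (\<lambda>\<omega>. exp (m * Y \<omega> * exp (r * T)))"
  shows "continuous_on {0..T} (z_fun M Y m r T)"
proof (rule continuous_on_sequentiallyI)
  fix u t assume u: "\<forall>n. u n \<in> {0..T}" and lim: "u \<longlonglongrightarrow> t"
  show "(\<lambda>n. z_fun M Y m r T (u n)) \<longlonglongrightarrow> z_fun M Y m r T t"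
    unfolding z_fun_def
  proof (rule integral_dominated_convergence[OF _ _ int])
    show "AE \<omega> in M. (\<lambda>n. exp (m * Y \<omega> * exp (r * (T - u n)))) \<longlonglongrightarrow> exp (m * Y \<omega> * exp (r * (T - t)))"
      by (intro AE_I2 tendsto_intros lim)
    show "AE \<omega> in M. norm (exp (m * Y \<omega> * exp (r * (T - u n)))) \<le> exp (m * Y \<omega> * exp (r * T))" for n
      using pos
    proof eventually_elim
      case (elim \<omega>)
      have "r * (T - u n) \<le> r * T" using u \<open>r \<ge> 0\<close> by (intro mult_left_mono) auto
      then show ?case using elim \<open>m \<ge> 0\<close> by (auto intro!: mult_left_mono)
    qed
  qed measurable
qed

lemma C1_funD:
  fixes f :: "real \<Rightarrow> real"
  assumes "f \<in> C1_fun a b B" "t \<in> {a..b}"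
  shows "(f has_real_derivative vector_derivative f (at t within {a..b})) (at t within {a..b})"
  using assms unfolding C1_fun_def has_real_derivative_iff_has_vector_derivative
  by (auto simp: vector_derivative_works)

text \<open>On a nondegenerate interval derivatives within it are unique, so
  \<open>vector_derivative\<close> returns the given \<open>f'\<close>.\<close>

lemma C1_funI:
  fixes f f' :: "real \<Rightarrow> real"
  assumes "a < b" and "f \<in> {a..b} \<rightarrow>\<^sub>E B"
    and der: "\<And>t. t \<in> {a..b} \<Longrightarrow> (f has_real_derivative f' t) (at t within {a..b})"
    and "continuous_on {a..b} f'"
  shows "f \<in> C1_fun a b B"
proof -
  have "vector_derivative f (at t within {a..b}) = f' t" if "t \<in> {a..b}" for t
    using vector_derivative_within_closed_interval[OF \<open>a < b\<close> that] der[OF that]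
    by (simp add: has_real_derivative_iff_has_vector_derivative)
  moreover have "f differentiable (at t within {a..b})" if "t \<in> {a..b}" for t
    using der[OF that] by (meson has_field_derivative_imp_has_derivative differentiableI)
  ultimately show ?thesis
    using assms unfolding C1_fun_def by (auto cong: continuous_on_cong_simp)
qed

section \<open>The cyclic system of the theorem\<close>

theorem theorem4p2:
  fixes n :: nat and lam :: "nat \<Rightarrow> real"
    and T m c \<sigma> \<beta> \<mu> r :: real
    and M :: "'a measure" and Y :: "'a \<Rightarrow> real"
  assumes "n \<ge> 1"
    and "\<And>i. i \<in> {1..n} \<Longrightarrow> lam i > 0"
    and "T > 0" and "m > 0" and "c > 0" and "\<sigma> > 0" and "\<beta> > 0"
    and "\<mu> > r" and "r > 0"
    and "prob_space M"
    and "prob_space.random_variable M borel Y"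
    and "AE \<omega> in M. Y \<omega> > 0"
    and "\<And>t. t \<in> {0..T} \<Longrightarrow> integrable M (\<lambda>\<omega>. exp (m * Y \<omega> * exp (r * (T - t))))"
  shows "\<exists>!\<phi>. \<phi> \<in> {1..n} \<rightarrow>\<^sub>E C1_fun 0 T {0..} \<and>
    (\<forall>t\<in>{0..T}.
       (\<forall>i\<in>{1..<n}. vector_derivative (\<phi> i) (at t within {0..T})
          - lam i * \<phi> i t + lam i * \<phi> (i + 1) t = 0) \<and>
       vector_derivative (\<phi> n) (at t within {0..T})
          - lam n * \<phi> n t + lam n * z_fun M Y m r T t * \<phi> 1 t = 0) \<and>
    (\<forall>i\<in>{1..n}. \<phi> i T = exp (- F_term c m r \<mu> \<beta> T T))"
proof -
  let ?K = "exp (- F_term c m r \<mu> \<beta> T T)"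
  define z where "z = z_fun M Y m r T"
  \<comment> \<open>With the cyclic successor \<open>s\<close> and the coefficients
    \<open>q\<close>, both kinds of equation take one form. For \<open>n = 1\<close> the map
    \<open>s\<close> fixes the only index.\<close>
  define s where "s i = (if i = n then 1 else i + 1)" for i
  define q where "q i t = (if i = n then lam n * z t else lam i)" for i t
  have s: "s \<in> {1..n} \<rightarrow> {1..n}" using assms(1) by (auto simp: s_def)
  \<comment> \<open>The moment condition enters at \<open>t = 0\<close>, the worst case.\<close>
  have "continuous_on {0..T} z"
    unfolding z_def using assms(3,4,9,11,12) assms(13)[of 0] by (intro z_fun_continuous) auto
  then have q: "continuous_on {0..T} (q i)" for i
    unfolding q_def by (cases "i = n") (auto intro!: continuous_intros)
  \<comment> \<open>No restriction on \<open>t\<close> is called for: an integral that does not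
    exist has the default value 0.\<close>
  have z0: "z t \<ge> 0" for t
    unfolding z_def z_fun_def by simp
  have q0: "q i t \<ge> 0" if "i \<in> {1..n}" for i t
    using assms(2)[OF that] z0 that by (auto simp: q_def)
  define sys where "sys \<phi> \<longleftrightarrow> (\<forall>i\<in>{1..n}. \<forall>t\<in>{0..T}.
      (\<phi> i has_real_derivative lam i * \<phi> i t - q i t * \<phi> (s i) t) (at t within {0..T}))" for \<phi>
  \<comment> \<open>Membership in the function space supplies differentiability, so an equation for
    \<open>vector_derivative\<close> carries the same information as
    \<open>has_real_derivative\<close>. Separating the index \<open>n\<close> recovers the two kinds
    of equation.\<close>
  have sys: "sys \<phi> \<longleftrightarrow> (\<forall>t\<in>{0..T}.
       (\<forall>i\<in>{1..<n}. vector_derivative (\<phi> i) (at t within {0..T})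
          - lam i * \<phi> i t + lam i * \<phi> (i + 1) t = 0) \<and>
       vector_derivative (\<phi> n) (at t within {0..T})
          - lam n * \<phi> n t + lam n * z_fun M Y m r T t * \<phi> 1 t = 0)"
    if C1: "\<phi> \<in> {1..n} \<rightarrow>\<^sub>E C1_fun 0 T {0..}" for \<phi>
  proof -
    have "(\<phi> i has_real_derivative D) (at t within {0..T})
        \<longleftrightarrow> vector_derivative (\<phi> i) (at t within {0..T}) = D"
      if "i \<in> {1..n}" "t \<in> {0..T}" for i t D
      using C1_funD[OF PiE_mem[OF C1 that(1)] that(2)]
        vector_derivative_within_closed_interval[OF \<open>T > 0\<close> that(2), of "\<phi> i" D]
      by (auto simp: has_real_derivative_iff_has_vector_derivative)
    then have "sys \<phi> \<longleftrightarrow> (\<forall>t\<in>{0..T}. \<forall>i\<in>{1..n}.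
        vector_derivative (\<phi> i) (at t within {0..T}) = lam i * \<phi> i t - q i t * \<phi> (s i) t)"
      unfolding sys_def by blast
    moreover have "{1..n} = insert n {1..<n}" using assms(1) by auto
    ultimately show ?thesis
      by (auto simp: q_def s_def z_def algebra_simps)
  qed
  have fin: "finite {1..n}" by simp
  from backward_diagonal_system_exists[where q = q and k = "\<lambda>_. ?K" and l = lam,
      OF fin s less_imp_le[OF \<open>T > 0\<close>] q q0 exp_ge_zero]
  obtain \<phi> where "\<forall>i\<in>{1..n}. \<phi> i T = ?K \<and> (\<forall>t\<in>{0..T}. \<phi> i t \<ge> 0 \<and>
    (\<phi> i has_real_derivative lam i * \<phi> i t - q i t * \<phi> (s i) t) (at t within {0..T}))" ..
  then have \<phi>:
    "\<And>i t. i \<in> {1..n} \<Longrightarrow> t \<in> {0..T} \<Longrightarrow>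
      (\<phi> i has_real_derivative lam i * \<phi> i t - q i t * \<phi> (s i) t) (at t within {0..T})"
    "\<And>i t. i \<in> {1..n} \<Longrightarrow> t \<in> {0..T} \<Longrightarrow> \<phi> i t \<ge> 0"
    "\<And>i. i \<in> {1..n} \<Longrightarrow> \<phi> i T = ?K"
    by auto
  \<comment> \<open>Restriction in both index and time makes the solution extensional, as the
    function spaces demand.\<close>
  define \<Phi> where "\<Phi> = (\<lambda>i\<in>{1..n}. \<lambda>t\<in>{0..T}. \<phi> i t)"
  have \<Phi>: "\<Phi> i t = \<phi> i t" if "i \<in> {1..n}" "t \<in> {0..T}" for i t
    using that by (simp add: \<Phi>_def)
  \<comment> \<open>A derivative within \<open>{0..T}\<close> sees only values there, so it carries
    over from \<open>\<phi>\<close>.\<close>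
  have der: "(\<Phi> i has_real_derivative lam i * \<Phi> i t - q i t * \<Phi> (s i) t) (at t within {0..T})"
    if "i \<in> {1..n}" "t \<in> {0..T}" for i t
  proof -
    have "s i \<in> {1..n}" using s that(1) by (rule funcset_mem)
    then have "(\<phi> i has_real_derivative lam i * \<Phi> i t - q i t * \<Phi> (s i) t) (at t within {0..T})"
      using \<phi>(1)[OF that] by (simp only: \<Phi> that)
    with that(2) \<Phi>[OF that(1)] show ?thesis
      unfolding has_real_derivative_iff_has_vector_derivative by (rule has_vector_derivative_transform)
  qed
  have cont: "continuous_on {0..T} (\<Phi> i)" if "i \<in> {1..n}" for i
    using der[OF that] by (rule DERIV_continuous_on)
  have C1: "\<Phi> \<in> {1..n} \<rightarrow>\<^sub>E C1_fun 0 T {0..}"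
  proof (rule PiE_I)
    fix i assume i: "i \<in> {1..n}"
    \<comment> \<open>Continuity of the derivative is read off from the right-hand side of the
      system.\<close>
    have "continuous_on {0..T} (\<lambda>t. lam i * \<Phi> i t - q i t * \<Phi> (s i) t)"
      using i funcset_mem[OF s i] by (intro continuous_intros q cont)
    moreover have "\<Phi> i \<in> {0..T} \<rightarrow>\<^sub>E {0..}"
      using \<phi>(2)[OF i] i by (auto simp: \<Phi>_def)
    ultimately show "\<Phi> i \<in> C1_fun 0 T {0..}"
      using C1_funI[OF \<open>T > 0\<close> _ der[OF i]] by blast
  qed (auto simp: \<Phi>_def)
  show ?thesis
  proof (rule ex1I[of _ \<Phi>], intro conjI C1)
    have "sys \<Phi>" unfolding sys_def using der by blast
    then show "\<forall>t\<in>{0..T}.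
       (\<forall>i\<in>{1..<n}. vector_derivative (\<Phi> i) (at t within {0..T})
          - lam i * \<Phi> i t + lam i * \<Phi> (i + 1) t = 0) \<and>
       vector_derivative (\<Phi> n) (at t within {0..T})
          - lam n * \<Phi> n t + lam n * z_fun M Y m r T t * \<Phi> 1 t = 0"
      unfolding sys[OF C1] .
    show "\<forall>i\<in>{1..n}. \<Phi> i T = ?K" using \<phi>(3) \<open>T > 0\<close> by (simp add: \<Phi>)
  next
    fix \<phi>' assume \<phi>': "\<phi>' \<in> {1..n} \<rightarrow>\<^sub>E C1_fun 0 T {0..} \<and>
    (\<forall>t\<in>{0..T}.
       (\<forall>i\<in>{1..<n}. vector_derivative (\<phi>' i) (at t within {0..T})
          - lam i * \<phi>' i t + lam i * \<phi>' (i + 1) t = 0) \<and>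
       vector_derivative (\<phi>' n) (at t within {0..T})
          - lam n * \<phi>' n t + lam n * z_fun M Y m r T t * \<phi>' 1 t = 0) \<and>
    (\<forall>i\<in>{1..n}. \<phi>' i T = ?K)"
    then have C1': "\<phi>' \<in> {1..n} \<rightarrow>\<^sub>E C1_fun 0 T {0..}" ..
    have "sys \<phi>'" unfolding sys[OF C1'] using \<phi>' by (elim conjE)
    have terminal': "\<forall>i\<in>{1..n}. \<phi>' i T = ?K" using \<phi>' by (elim conjE)
    have eq: "\<phi>' i t = \<Phi> i t" if "i \<in> {1..n}" "t \<in> {0..T}" for i t
    proof (rule backward_diagonal_system_unique[where \<phi> = \<phi>' and \<phi>' = \<Phi> and q = q and l = lam,
          OF fin s q _ der _ that])
      show "(\<phi>' i has_real_derivative lam i * \<phi>' i t - q i t * \<phi>' (s i) t) (at t within {0..T})"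
        if "i \<in> {1..n}" "t \<in> {0..T}" for i t
        using \<open>sys \<phi>'\<close> that unfolding sys_def by blast
      show "\<phi>' i T = \<Phi> i T" if "i \<in> {1..n}" for i
        using bspec[OF terminal' that] \<phi>(3)[OF that] \<Phi>[OF that, of T] \<open>T > 0\<close> by simp
    qed
    \<comment> \<open>Extensionality, first in the index and then in time, turns agreement on
      \<open>{0..T}\<close> into equality.\<close>
    show "\<phi>' = \<Phi>"
    proof (rule PiE_ext[OF C1' C1])
      fix i assume i: "i \<in> {1..n}"
      have "\<phi>' i \<in> {0..T} \<rightarrow>\<^sub>E {0..}" "\<Phi> i \<in> {0..T} \<rightarrow>\<^sub>E {0..}"
        using PiE_mem[OF C1' i] PiE_mem[OF C1 i] by (simp_all add: C1_fun_def)
      then show "\<phi>' i = \<Phi> i" by (rule PiE_ext) (rule eq[OF i])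
    qed
  qed
qed

end
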